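(* Let $\mathcal{X}=\{1,\dots,m\}$, let $q$ be a positive measure on $\mathcal{X}$ with full support, and let $A\in\mathbb{R}^{d\times m}$ be a matrix whose row span contains $(1,\dots,1)$. A probability distribution $p$ on $\mathcal{X}$ is an element of the closure $\overline{\mathcal{E}_{q,A}}$ of the exponential family $\mathcal{E}_{q,A}$ if and only if $$p^{n^{+}} q^{n^{-}} = p^{n^{-}} q^{n^{+}}\qquad\text{for all } n\in\ker A .$$
   Context: $\mathcal{P}(\mathcal{X})$ is the open simplex of probability measures with full support on $\mathcal{X}$, viewed as a subset of $\mathbb{R}^{\mathcal{X}}$; closures are taken in the standard topology of $\mathbb{R}^{\mathcal{X}}$. The columns of $A$ are denoted $a_x\in\mathbb{R}^d$, $x\in\mathcal{X}$. The exponential family associated with $q$ and $A$ is $$\mathcal{E}_{q,A}=\Big\{p_\theta\in\mathcal{P}(\mathcal{X}) : p_\theta(x)=\frac{q(x)}{Z_\theta}\exp(\theta^{T}a_x),\ \theta\in\mathbb{R}^d\Big\},\qquad Z_\theta=\sum_{x\in\mathcal{X}}q(x)\exp(\theta^{T}a_x).$$ For $n\in\mathbb{R}^{\mathcal{X}}$ put $n^{+}(x)=\max(n(x),0)$ and $n^{-}(x)=\max(-n(x),0)$, so $n=n^{+}-n^{-}$. For non-negative $p,u\in\mathbb{R}^{\mathcal{X}}$ put $p^{u}=\prod_{x\in\mathcal{X}}p(x)^{u(x)}$, with the convention $0^0=1$. *)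

theory Defs
  imports "HOL-Analysis.Analysis"
begin

definition prob_distributions :: "(real ^ 'x) set" where
  "prob_distributions = {p. (\<forall>x. 0 \<le> p $ x) \<and> (\<Sum>x\<in>UNIV. p $ x) = 1}"

definition open_simplex :: "(real ^ 'x) set" where
  "open_simplex = {p. (\<forall>x. 0 < p $ x) \<and> (\<Sum>x\<in>UNIV. p $ x) = 1}"

definition partition_fun :: "real ^ 'x \<Rightarrow> real ^ 'x ^ 'd \<Rightarrow> real ^ 'd \<Rightarrow> real" where
  "partition_fun q A \<theta> = (\<Sum>x\<in>UNIV. q $ x * exp (\<theta> \<bullet> column x A))"

definition exp_family :: "real ^ 'x \<Rightarrow> real ^ 'x ^ 'd \<Rightarrow> (real ^ 'x) set" where
  "exp_family q A = {p \<in> open_simplex.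
     \<exists>\<theta>. \<forall>x. p $ x = q $ x / partition_fun q A \<theta> * exp (\<theta> \<bullet> column x A)}"

definition mat_ker :: "real ^ 'x ^ 'd \<Rightarrow> (real ^ 'x) set" where
  "mat_ker A = {n. A *v n = 0}"

definition pos_part :: "real ^ 'x \<Rightarrow> real ^ 'x" where
  "pos_part n = (\<chi> x. max (n $ x) 0)"

definition neg_part :: "real ^ 'x \<Rightarrow> real ^ 'x" where
  "neg_part n = (\<chi> x. max (- n $ x) 0)"

text \<open>For non-negative vectors. The case distinction implements the convention that
  zero to the power zero is one; in the library, \<open>0 powr 0 = 0\<close>.\<close>

definition vec_powr :: "real ^ 'x \<Rightarrow> real ^ 'x \<Rightarrow> real" where
  "vec_powr p u = (\<Prod>x\<in>UNIV. if u $ x = 0 then 1 else p $ x powr u $ x)"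

end

theory Submission
  imports Defs
begin

text \<open>
  Taking logarithms, the binomial equation of \<open>n \<in> ker A\<close> says that \<open>n\<close> is orthogonal to
  \<open>ln (p / q)\<close>, as long as \<open>p\<close> is positive on the support of \<open>n\<close>
  (\<open>binomial_eq_iff_log_orthogonal\<close>).  On the exponential family
  \<open>ln (p / q)\<close> is a row combination of \<open>A\<close> plus a constant, and constants are row combinations
  too, so the equations hold there; they pass to the closure because a power with
  positive exponent is continuous in its base down to zero.

  Conversely, let \<open>F\<close> be the support of a solution \<open>p\<close>.  The equations for the \<open>n\<close> supported in
  \<open>F\<close> say that \<open>ln (p / q)\<close> agrees on \<open>F\<close> with a row combination \<open>\<theta>\<^sub>0\<^sup>T A\<close>, by linear duality
  (\<open>row_combination_interpolates\<close>).  If exactly one of \<open>n\<^sup>+\<close>, \<open>n\<^sup>-\<close> had its support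
  in \<open>F\<close>, the equation of \<open>n\<close> would equate zero with something positive, so no \<open>n \<in> ker A\<close> is non-negative and
  nonzero outside \<open>F\<close>.  By a theorem of the alternative (\<open>stiemke_outside\<close>) some \<open>\<theta>\<^sub>1\<^sup>T A\<close> vanishes on
  \<open>F\<close> and is positive outside: the columns indexed by \<open>F\<close> are those on a face of the cone that
  all columns span.  Along the ray \<open>\<theta>\<^sub>0 - t \<theta>\<^sub>1\<close> the family then keeps the weight ratios of \<open>p\<close>
  on \<open>F\<close>, loses all mass outside, and so tends to \<open>p\<close> (\<open>exp_family_ray_limit\<close>).
\<close>

section \<open>Linear duality for the columns of a matrix\<close>

lemma inner_matrix_vector_mult_columns:
  fixes A :: "real ^ 'x ^ 'd"
  shows "\<theta> \<bullet> (A *v n) = (\<Sum>x\<in>UNIV. n $ x * (\<theta> \<bullet> column x A))"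
  by (simp add: matrix_mult_sum inner_sum_right scalar_mult_eq_scaleR)

lemma mat_ker_sum_zero:
  fixes A :: "real ^ 'x ^ 'd"
  assumes one: "(\<chi> x. 1) \<in> span (rows A)" and n: "n \<in> mat_ker A"
  shows "(\<Sum>x\<in>UNIV. n $ x) = 0"
proof -
  have "orthogonal n r" if "r \<in> rows A" for r
  proof -
    from that obtain i where r: "r = row i A" by (auto simp: rows_def)
    have "(A *v n) $ i = 0" using n by (simp add: mat_ker_def)
    then show ?thesis
      by (simp add: r orthogonal_def row_def inner_vec_def matrix_vector_mult_def mult.commute)
  qed
  then have "orthogonal n (\<chi> x. 1)" using orthogonal_to_span one by blast
  then show ?thesis by (simp add: orthogonal_def inner_vec_def)
qed

text \<open>The vectors that agree on \<open>F\<close> with a row combination form the sum of the row space and the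
  vectors that vanish on \<open>F\<close>; the orthogonal complement of that sum consists of the kernel vectors
  supported in \<open>F\<close>.\<close>

lemma row_combination_interpolates:
  fixes A :: "real ^ 'x ^ 'd" and l :: "real ^ 'x"
  assumes orth: "\<And>n. n \<in> mat_ker A \<Longrightarrow> (\<And>x. x \<notin> F \<Longrightarrow> n $ x = 0) \<Longrightarrow> n \<bullet> l = 0"
  shows "\<exists>\<theta>. \<forall>x\<in>F. \<theta> \<bullet> column x A = l $ x"
proof -
  define S :: "(real ^ 'x) set" where "S = {w. \<exists>\<theta>. \<forall>x\<in>F. \<theta> \<bullet> column x A = w $ x}"
  have "subspace S"
  proof (rule subspaceI)
    show "0 \<in> S" unfolding S_def by (auto intro: exI[of _ 0])
  next
    fix v w assume "v \<in> S" "w \<in> S"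
    then obtain a b where "\<forall>x\<in>F. a \<bullet> column x A = v $ x" "\<forall>x\<in>F. b \<bullet> column x A = w $ x"
      unfolding S_def by auto
    then show "v + w \<in> S" unfolding S_def
      by (auto intro!: exI[of _ "a + b"] simp: inner_add_left)
  next
    fix c and v assume "v \<in> S"
    then obtain a where "\<forall>x\<in>F. a \<bullet> column x A = v $ x"
      unfolding S_def by auto
    then show "c *\<^sub>R v \<in> S" unfolding S_def
      by (auto intro!: exI[of _ "c *\<^sub>R a"])
  qed
  then have span: "span S = S" by (simp add: span_eq_iff)
  obtain y z where y: "y \<in> S" and z: "\<And>w. w \<in> S \<Longrightarrow> orthogonal z w" and l: "l = y + z"
    using orthogonal_subspace_decomp_exists[of S l] span by metis
  have off: "z $ x = 0" if "x \<notin> F" for x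
  proof -
    have "axis x 1 \<in> S" unfolding S_def using that
      by (auto intro!: exI[of _ 0] simp: axis_def)
    from z[OF this] show ?thesis by (simp add: orthogonal_def inner_axis)
  qed
  have "\<theta> \<bullet> (A *v z) = 0" for \<theta>
  proof -
    have "(\<chi> x. \<theta> \<bullet> column x A) \<in> S" unfolding S_def by auto
    from z[OF this] show ?thesis
      by (simp add: orthogonal_def inner_vec_def[of z] inner_matrix_vector_mult_columns)
  qed
  from this[of "A *v z"] have "z \<in> mat_ker A" by (simp add: mat_ker_def)
  then have "z \<bullet> l = 0" using off by (rule orth)
  moreover have "z \<bullet> y = 0" using z[OF y] by (simp add: orthogonal_def)
  ultimately have "z = 0" by (simp add: l inner_add_right)
  then show ?thesis using y l unfolding S_def by simp
qed

text \<open>A relative form of Stiemke's theorem.  The hypothesis makes the subspace of all vectors that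
  agree outside \<open>F\<close> with a kernel vector miss the simplex on the complement of \<open>F\<close>.  A functional
  separating the two vanishes on the subspace, which contains both the kernel and the
  vectors supported in \<open>F\<close>.\<close>

lemma stiemke_outside:
  fixes A :: "real ^ 'x ^ 'd"
  assumes no: "\<And>n. n \<in> mat_ker A \<Longrightarrow> (\<And>x. x \<notin> F \<Longrightarrow> 0 \<le> n $ x) \<Longrightarrow> (\<And>x. x \<notin> F \<Longrightarrow> n $ x = 0)"
  shows "\<exists>\<theta>. (\<forall>x\<in>F. \<theta> \<bullet> column x A = 0) \<and> (\<forall>x. x \<notin> F \<longrightarrow> 0 < \<theta> \<bullet> column x A)"
proof (cases "F = UNIV")
  case True
  then show ?thesis by (auto intro: exI[of _ 0])
next
  case False
  define S :: "(real ^ 'x) set" where "S = {w. \<exists>n\<in>mat_ker A. \<forall>x. x \<notin> F \<longrightarrow> w $ x = n $ x}"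
  define T :: "(real ^ 'x) set" where "T = convex hull ((\<lambda>x. axis x 1) ` (- F))"
  have sub: "subspace S"
  proof (rule subspaceI)
    show "0 \<in> S" unfolding S_def mat_ker_def by (auto intro: exI[of _ 0])
  next
    fix v w assume "v \<in> S" "w \<in> S"
    then obtain a b where "a \<in> mat_ker A" "b \<in> mat_ker A"
      "\<forall>x. x \<notin> F \<longrightarrow> v $ x = a $ x" "\<forall>x. x \<notin> F \<longrightarrow> w $ x = b $ x"
      unfolding S_def by auto
    then show "v + w \<in> S" unfolding S_def mat_ker_def
      by (auto intro!: exI[of _ "a + b"] simp: matrix_vector_right_distrib)
  next
    fix c and v assume "v \<in> S"
    then obtain a where "a \<in> mat_ker A" "\<forall>x. x \<notin> F \<longrightarrow> v $ x = a $ x"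
      unfolding S_def by auto
    then show "c *\<^sub>R v \<in> S" unfolding S_def mat_ker_def
      by (auto intro!: exI[of _ "c *\<^sub>R a"] simp: matrix_vector_mult_scaleR)
  qed
  define D :: "(real ^ 'x) set" where "D = {w. (\<forall>x. 0 \<le> w $ x) \<and> (\<Sum>x\<in>-F. w $ x) = 1}"
  have "convex D"
    unfolding convex_def D_def
    by (auto simp: sum.distrib sum_distrib_left[symmetric])
  moreover have "(\<lambda>x. axis x 1) ` (- F) \<subseteq> D"
    by (auto simp: D_def axis_def if_distrib cong: if_cong)
  ultimately have "T \<subseteq> D" unfolding T_def by (rule hull_minimal[rotated])
  moreover have "S \<inter> D = {}"
  proof (rule ccontr)
    assume "S \<inter> D \<noteq> {}"
    then obtain w n where n: "n \<in> mat_ker A" and w: "\<forall>x. x \<notin> F \<longrightarrow> w $ x = n $ x"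
      and pos: "\<And>x. 0 \<le> w $ x" and one: "(\<Sum>x\<in>-F. w $ x) = 1"
      unfolding S_def D_def by blast
    have "n $ x = 0" if "x \<notin> F" for x
      using no[OF n _ that] pos w by metis
    then have "(\<Sum>x\<in>-F. w $ x) = 0" using w by simp
    then show False using one by simp
  qed
  ultimately have disj: "S \<inter> T = {}" by blast
  have "T \<noteq> {}" using False unfolding T_def by auto
  moreover have "compact T" unfolding T_def by (simp add: finite_imp_compact_convex_hull)
  moreover have "convex T" unfolding T_def by simp
  ultimately obtain v b where S: "\<And>w. w \<in> S \<Longrightarrow> v \<bullet> w < b" and T: "\<And>w. w \<in> T \<Longrightarrow> b < v \<bullet> w"
    using separating_hyperplane_closed_compact[of S T] sub disj
    by (metis closed_subspace subspace_imp_convex)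
  have b: "0 < b" using S[OF subspace_0[OF sub]] by simp
  have orth: "v \<bullet> w = 0" if "w \<in> S" for w
  proof (rule ccontr)
    assume nz: "v \<bullet> w \<noteq> 0"
    \<comment> \<open>a functional bounded above on a subspace vanishes: rescale \<open>w\<close> until it attains \<open>b\<close>\<close>
    have "v \<bullet> ((b / (v \<bullet> w)) *\<^sub>R w) < b" using S subspace_scale[OF sub that] by blast
    then show False using nz by simp
  qed
  obtain \<theta> where \<theta>: "\<And>x. \<theta> \<bullet> column x A = v $ x"
  proof -
    have "\<exists>\<theta>. \<forall>x\<in>UNIV. \<theta> \<bullet> column x A = v $ x"
    proof (rule row_combination_interpolates)
      fix n assume "n \<in> mat_ker A"
      then have "n \<in> S" unfolding S_def by auto
      then show "n \<bullet> v = 0" using orth by (simp add: inner_commute)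
    qed
    then show ?thesis using that by auto
  qed
  have "v $ x = 0" if "x \<in> F" for x
  proof -
    have "axis x 1 \<in> S" unfolding S_def mat_ker_def using that
      by (auto intro!: exI[of _ 0] simp: axis_def)
    from orth[OF this] show ?thesis by (simp add: inner_axis)
  qed
  moreover have "0 < v $ x" if "x \<notin> F" for x
  proof -
    have "axis x 1 \<in> T" unfolding T_def using that by (auto intro: hull_inc)
    from T[OF this] b show ?thesis by (simp add: inner_axis)
  qed
  ultimately show ?thesis by (intro exI[of _ \<theta>]) (simp add: \<theta>)
qed

section \<open>Binomial equations and logarithms\<close>

text \<open>Where the exponent vanishes the value \<open>ln 0\<close> is harmless.\<close>

lemma vec_powr_eq_exp:
  assumes "\<And>x. u $ x \<noteq> 0 \<Longrightarrow> 0 < p $ x"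
  shows "vec_powr p u = exp (\<Sum>x\<in>UNIV. u $ x * ln (p $ x))"
proof -
  have "(if u $ x = 0 then 1 else p $ x powr u $ x) = exp (u $ x * ln (p $ x))" for x
    using assms[of x] by (cases "u $ x = 0") (simp_all add: powr_def)
  then show ?thesis unfolding vec_powr_def by (simp add: exp_sum)
qed

lemma vec_powr_eq_0:
  assumes "u $ x \<noteq> 0" "p $ x = 0"
  shows "vec_powr p u = 0"
  unfolding vec_powr_def
proof (rule prod_zero)
  show "\<exists>x\<in>UNIV. (if u $ x = 0 then 1 else p $ x powr u $ x) = 0"
    using assms by (intro bexI[of _ x]) auto
qed simp

lemma binomial_eq_iff_log_orthogonal:
  fixes p q n :: "real ^ 'x"
  assumes q: "\<And>x. 0 < q $ x" and p: "\<And>x. n $ x \<noteq> 0 \<Longrightarrow> 0 < p $ x"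
  shows "vec_powr p (pos_part n) * vec_powr q (neg_part n) =
      vec_powr p (neg_part n) * vec_powr q (pos_part n) \<longleftrightarrow>
      (\<Sum>x\<in>UNIV. n $ x * (ln (p $ x) - ln (q $ x))) = 0"
proof -
  let ?s = "\<lambda>u r. \<Sum>x\<in>UNIV. u $ x * ln (r $ x)"
  have pp: "vec_powr p (pos_part n) = exp (?s (pos_part n) p)"
    by (rule vec_powr_eq_exp) (auto simp: pos_part_def intro!: p)
  have pn: "vec_powr p (neg_part n) = exp (?s (neg_part n) p)"
    by (rule vec_powr_eq_exp) (auto simp: neg_part_def intro!: p)
  have qq: "vec_powr q u = exp (?s u q)" for u
    by (rule vec_powr_eq_exp) (rule q)
  have "n $ x * (ln (p $ x) - ln (q $ x)) =
      (pos_part n $ x * ln (p $ x) + neg_part n $ x * ln (q $ x)) -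
      (neg_part n $ x * ln (p $ x) + pos_part n $ x * ln (q $ x))" for x
    by (simp add: pos_part_def neg_part_def max_def algebra_simps)
  then have "(\<Sum>x\<in>UNIV. n $ x * (ln (p $ x) - ln (q $ x))) =
      (?s (pos_part n) p + ?s (neg_part n) q) - (?s (neg_part n) p + ?s (pos_part n) q)"
    by (simp only: sum.distrib sum_subtractf)
  then show ?thesis by (simp add: pp pn qq flip: exp_add)
qed

lemma tendsto_vec_powr:
  fixes f :: "'a \<Rightarrow> real ^ 'x"
  assumes f: "(f \<longlongrightarrow> p) G" and pos: "\<And>a x. 0 \<le> f a $ x" and u: "\<And>x. 0 \<le> u $ x"
  shows "((\<lambda>a. vec_powr (f a) u) \<longlongrightarrow> vec_powr p u) G"
  unfolding vec_powr_def
proof (rule tendsto_prod)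
  fix x :: 'x
  have "((\<lambda>a. f a $ x powr u $ x) \<longlongrightarrow> p $ x powr u $ x) G" if "u $ x \<noteq> 0"
    using u[of x] that pos by (intro tendsto_powr' tendsto_vec_nth f tendsto_const) auto
  then show "((\<lambda>a. if u $ x = 0 then 1 else f a $ x powr u $ x) \<longlongrightarrow>
      (if u $ x = 0 then 1 else p $ x powr u $ x)) G"
    by auto
qed

section \<open>The exponential family and its limits along rays\<close>

lemma partition_fun_pos:
  fixes q :: "real ^ 'x" and A :: "real ^ 'x ^ 'd"
  assumes "\<And>x. 0 < q $ x"
  shows "0 < partition_fun q A \<theta>"
  unfolding partition_fun_def by (rule sum_pos) (auto simp: assms)

lemma exp_family_member:
  fixes q :: "real ^ 'x" and A :: "real ^ 'x ^ 'd"
  assumes "\<And>x. 0 < q $ x"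
  shows "(\<chi> x. q $ x / partition_fun q A \<theta> * exp (\<theta> \<bullet> column x A)) \<in> exp_family q A"
proof -
  have Z: "0 < partition_fun q A \<theta>" using assms by (rule partition_fun_pos)
  have "(\<Sum>x\<in>UNIV. q $ x / partition_fun q A \<theta> * exp (\<theta> \<bullet> column x A)) =
      partition_fun q A \<theta> / partition_fun q A \<theta>"
    by (subst (2) partition_fun_def) (simp add: sum_divide_distrib)
  then show ?thesis using Z assms unfolding exp_family_def open_simplex_def by auto
qed

lemma exp_family_binomial_eq:
  fixes q p :: "real ^ 'x" and A :: "real ^ 'x ^ 'd"
  assumes q: "\<And>x. 0 < q $ x" and one: "(\<chi> x. 1) \<in> span (rows A)"
    and p: "p \<in> exp_family q A" and n: "n \<in> mat_ker A"
  shows "vec_powr p (pos_part n) * vec_powr q (neg_part n) =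
    vec_powr p (neg_part n) * vec_powr q (pos_part n)"
proof -
  obtain \<theta> where pos: "\<And>x. 0 < p $ x"
    and eq: "\<And>x. p $ x = q $ x / partition_fun q A \<theta> * exp (\<theta> \<bullet> column x A)"
    using p unfolding exp_family_def open_simplex_def by blast
  let ?Z = "partition_fun q A \<theta>"
  have "0 < ?Z" using q by (rule partition_fun_pos)
  then have log: "ln (p $ x) - ln (q $ x) = \<theta> \<bullet> column x A - ln ?Z" for x
    using q[of x] by (simp add: eq ln_mult ln_div)
  have "(\<Sum>x\<in>UNIV. n $ x * (ln (p $ x) - ln (q $ x))) =
      \<theta> \<bullet> (A *v n) - (\<Sum>x\<in>UNIV. n $ x) * ln ?Z"
    by (simp only: log inner_matrix_vector_mult_columns right_diff_distrib sum_subtractf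
        sum_distrib_right)
  also have "\<dots> = 0" using n mat_ker_sum_zero[OF one n] by (simp add: mat_ker_def)
  finally show ?thesis using binomial_eq_iff_log_orthogonal q pos by blast
qed

text \<open>The unnormalised weights at \<open>\<theta>\<^sub>0 - k \<theta>\<^sub>1\<close> are constantly \<open>p\<close> on \<open>F\<close> and decay exponentially
  in \<open>k\<close> elsewhere; the normalising constant tends to the total mass of \<open>p\<close>, which is one.\<close>

lemma exp_family_ray_limit:
  fixes q p :: "real ^ 'x" and A :: "real ^ 'x ^ 'd"
  assumes q: "\<And>x. 0 < q $ x" and total: "(\<Sum>x\<in>UNIV. p $ x) = 1"
    and on: "\<And>x. x \<in> F \<Longrightarrow> p $ x = q $ x * exp (\<theta>0 \<bullet> column x A)"
    and off: "\<And>x. x \<notin> F \<Longrightarrow> p $ x = 0"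
    and face: "\<And>x. x \<in> F \<Longrightarrow> \<theta>1 \<bullet> column x A = 0" "\<And>x. x \<notin> F \<Longrightarrow> 0 < \<theta>1 \<bullet> column x A"
  shows "p \<in> closure (exp_family q A)"
proof -
  define \<theta> where "\<theta> k = \<theta>0 - real k *\<^sub>R \<theta>1" for k
  have w: "(\<lambda>k. q $ x * exp (\<theta> k \<bullet> column x A)) \<longlonglongrightarrow> p $ x" for x
  proof (cases "x \<in> F")
    case True
    then show ?thesis by (simp add: \<theta>_def inner_diff_left face on)
  next
    case False
    let ?c = "\<theta>1 \<bullet> column x A"
    have "(\<lambda>k. q $ x * exp (\<theta>0 \<bullet> column x A) * exp (- ?c) ^ k) \<longlonglongrightarrow>
        q $ x * exp (\<theta>0 \<bullet> column x A) * 0"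
      using face(2)[OF False] by (intro tendsto_mult tendsto_const LIMSEQ_power_zero) simp
    moreover have "q $ x * exp (\<theta> k \<bullet> column x A) =
        q $ x * exp (\<theta>0 \<bullet> column x A) * exp (- ?c) ^ k" for k
      by (simp add: \<theta>_def inner_diff_left exp_diff exp_minus exp_of_nat_mult power_inverse
          divide_inverse)
    ultimately show ?thesis by (simp only: off[OF False] mult_zero_right)
  qed
  have Z: "(\<lambda>k. partition_fun q A (\<theta> k)) \<longlonglongrightarrow> 1"
    unfolding partition_fun_def total[symmetric] by (intro tendsto_sum w)
  let ?f = "\<lambda>k. \<chi> x. q $ x / partition_fun q A (\<theta> k) * exp (\<theta> k \<bullet> column x A)"
  have "?f \<longlonglongrightarrow> p"
  proof (rule vec_tendstoI)
    fix x
    show "(\<lambda>k. ?f k $ x) \<longlonglongrightarrow> p $ x"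
      using tendsto_divide[OF w[of x] Z] by simp
  qed
  moreover have "?f k \<in> exp_family q A" for k
    by (rule exp_family_member) (rule q)
  ultimately show ?thesis unfolding closure_sequential by (intro exI[of _ ?f]) blast
qed

section \<open>The implicit description of the closure\<close>

theorem theorem4:
  fixes q p :: "real ^ 'x" and A :: "real ^ 'x ^ 'd"
  assumes "\<forall>x. 0 < q $ x"
    and "(\<chi> x. 1) \<in> span (rows A)"
    and "p \<in> prob_distributions"
  shows "p \<in> closure (exp_family q A) \<longleftrightarrow>
    (\<forall>n \<in> mat_ker A.
       vec_powr p (pos_part n) * vec_powr q (neg_part n) =
       vec_powr p (neg_part n) * vec_powr q (pos_part n))"
proof
  have q: "\<And>x. 0 < q $ x" using assms(1) by simp
  assume "p \<in> closure (exp_family q A)"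
  then obtain f where f: "\<And>k. f k \<in> exp_family q A" and lim: "f \<longlonglongrightarrow> p"
    unfolding closure_sequential by blast
  have pos: "0 \<le> f k $ x" for k x
    using f[of k] unfolding exp_family_def open_simplex_def by (auto intro: less_imp_le)
  show "\<forall>n \<in> mat_ker A. vec_powr p (pos_part n) * vec_powr q (neg_part n) =
       vec_powr p (neg_part n) * vec_powr q (pos_part n)"
  proof
    fix n assume n: "n \<in> mat_ker A"
    have "(\<lambda>k. vec_powr (f k) (pos_part n) * vec_powr q (neg_part n)) \<longlonglongrightarrow>
        vec_powr p (pos_part n) * vec_powr q (neg_part n)"
      by (intro tendsto_mult_right tendsto_vec_powr lim pos) (simp add: pos_part_def)
    moreover have "(\<lambda>k. vec_powr (f k) (neg_part n) * vec_powr q (pos_part n)) \<longlonglongrightarrow>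
        vec_powr p (neg_part n) * vec_powr q (pos_part n)"
      by (intro tendsto_mult_right tendsto_vec_powr lim pos) (simp add: neg_part_def)
    ultimately show "vec_powr p (pos_part n) * vec_powr q (neg_part n) =
       vec_powr p (neg_part n) * vec_powr q (pos_part n)"
      unfolding exp_family_binomial_eq[OF q assms(2) f n] by (rule LIMSEQ_unique)
  qed
next
  have q: "\<And>x. 0 < q $ x" using assms(1) by simp
  assume binomial: "\<forall>n \<in> mat_ker A. vec_powr p (pos_part n) * vec_powr q (neg_part n) =
       vec_powr p (neg_part n) * vec_powr q (pos_part n)"
  have nonneg: "\<And>x. 0 \<le> p $ x" and total: "(\<Sum>x\<in>UNIV. p $ x) = 1"
    using assms(3) unfolding prob_distributions_def by auto
  define F where "F = {x. 0 < p $ x}"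
  have off: "p $ x = 0" if "x \<notin> F" for x
    using that nonneg[of x] unfolding F_def by simp
  have "\<exists>\<theta>. \<forall>x\<in>F. \<theta> \<bullet> column x A = (\<chi> x. ln (p $ x) - ln (q $ x)) $ x"
  proof (rule row_combination_interpolates)
    fix n assume n: "n \<in> mat_ker A" and supp: "\<And>x. x \<notin> F \<Longrightarrow> n $ x = 0"
    have "0 < p $ x" if "n $ x \<noteq> 0" for x
      using that supp F_def by blast
    then have "(\<Sum>x\<in>UNIV. n $ x * (ln (p $ x) - ln (q $ x))) = 0"
      using binomial n binomial_eq_iff_log_orthogonal q by blast
    then show "n \<bullet> (\<chi> x. ln (p $ x) - ln (q $ x)) = 0"
      by (simp add: inner_vec_def)
  qed
  then obtain \<theta>0 where \<theta>0: "\<And>x. x \<in> F \<Longrightarrow> \<theta>0 \<bullet> column x A = ln (p $ x) - ln (q $ x)"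
    by auto
  have on: "p $ x = q $ x * exp (\<theta>0 \<bullet> column x A)" if "x \<in> F" for x
  proof -
    have "0 < p $ x" using that by (simp add: F_def)
    then show ?thesis using q[of x] by (simp add: \<theta>0[OF that] exp_diff)
  qed
  have "\<exists>\<theta>. (\<forall>x\<in>F. \<theta> \<bullet> column x A = 0) \<and> (\<forall>x. x \<notin> F \<longrightarrow> 0 < \<theta> \<bullet> column x A)"
  proof (rule stiemke_outside, rule ccontr)
    fix n x assume n: "n \<in> mat_ker A" and ge: "\<And>x. x \<notin> F \<Longrightarrow> 0 \<le> n $ x"
      and x: "x \<notin> F" and nz: "n $ x \<noteq> 0"
    \<comment> \<open>the positive part of \<open>n\<close> meets a zero of \<open>p\<close> at \<open>x\<close>, the negative part stays in \<open>F\<close>\<close>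
    have "pos_part n $ x \<noteq> 0" using ge[OF x] nz by (simp add: pos_part_def)
    then have "vec_powr p (pos_part n) = 0" using off[OF x] by (rule vec_powr_eq_0)
    moreover have "0 < vec_powr p (neg_part n)"
    proof -
      have "0 < p $ y" if "neg_part n $ y \<noteq> 0" for y
        using that ge[of y] by (cases "y \<in> F") (auto simp: neg_part_def F_def)
      then show ?thesis by (subst vec_powr_eq_exp) auto
    qed
    moreover have "0 < vec_powr q (pos_part n)"
      by (subst vec_powr_eq_exp) (auto simp: q)
    moreover have "vec_powr p (pos_part n) * vec_powr q (neg_part n) =
       vec_powr p (neg_part n) * vec_powr q (pos_part n)"
      using binomial n by blast
    ultimately show False by simp
  qed
  then obtain \<theta>1 where face: "\<And>x. x \<in> F \<Longrightarrow> \<theta>1 \<bullet> column x A = 0"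
    "\<And>x. x \<notin> F \<Longrightarrow> 0 < \<theta>1 \<bullet> column x A"
    by blast
  show "p \<in> closure (exp_family q A)"
    using q total on off face by (rule exp_family_ray_limit)
qed

end
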